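(* For every $n\ge 3$, let $G_n^5$ be the graph on vertex set $\{a_1,\dots,a_n,b_1,\dots,b_n\}$ whose non-edges are exactly the $2n$ pairs of consecutive vertices on the cycle $a_1,b_1,a_2,b_2,\dots,a_n,b_n,a_1$ (i.e. $\{a_i,b_i\}$ for $1\le i\le n$, $\{b_i,a_{i+1}\}$ for $1\le i\le n-1$, and $\{b_n,a_1\}$), all other pairs of distinct vertices being adjacent. Then $G_n^5$ is word-representable.
   Context: All graphs are finite and simple. For a word $w$ and letters $i,j$, let $w_{ij}$ be the subsequence of $w$ consisting of all occurrences of $i$ and $j$; $i$ and $j$ alternate in $w$ if $w_{ij}$ contains no factor $ii$ or $jj$. A graph $G$ is word-representable if there is a word $w$ over $V(G)$ such that for all distinct $i,j\in V(G)$, $\{i,j\}\in E(G)$ if and only if $i$ and $j$ alternate in $w$. *)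

theory Defs
  imports "Graph_Theory.Pair_Digraph" "HOL-Library.Sublist"
begin

(* Finite simple graphs are the library's pair_graph: finite vertex set, symmetric loop-free
   arcs. The undirected edge {i, j} corresponds to the two arcs (i, j) and (j, i). *)

definition restrict_word :: "'a list \<Rightarrow> 'a \<Rightarrow> 'a \<Rightarrow> 'a list" where
  "restrict_word w i j = filter (\<lambda>x. x = i \<or> x = j) w"

(* sublist is the contiguous one, i.e. "is a factor of" (non-contiguous is subseq). *)
definition alternate :: "'a list \<Rightarrow> 'a \<Rightarrow> 'a \<Rightarrow> bool" where
  "alternate w i j \<longleftrightarrow>
     \<not> sublist [i, i] (restrict_word w i j) \<and> \<not> sublist [j, j] (restrict_word w i j)"

(* A word over V(G) need not use every letter. Demanding set w = pverts G would give the same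
   notion for finite graphs: prepending all unused letters once changes no alternation. *)
definition word_representable :: "'a pair_pre_digraph \<Rightarrow> bool" where
  "word_representable G \<longleftrightarrow>
     (\<exists>w. set w \<subseteq> pverts G \<and>
       (\<forall>i \<in> pverts G. \<forall>j \<in> pverts G. i \<noteq> j \<longrightarrow>
          ((i, j) \<in> parcs G \<longleftrightarrow> alternate w i j)))"

datatype vertex = A nat | B nat

definition G5_verts :: "nat \<Rightarrow> vertex set" where
  "G5_verts n = A ` {1..n} \<union> B ` {1..n}"

definition G5_nonedges :: "nat \<Rightarrow> vertex set set" where
  "G5_nonedges n =
     {{A i, B i} | i. 1 \<le> i \<and> i \<le> n} \<union>
     {{B i, A (i + 1)} | i. 1 \<le> i \<and> i \<le> n - 1} \<union>
     {{B n, A 1}}"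

definition G5 :: "nat \<Rightarrow> vertex pair_pre_digraph" where
  "G5 n =
     \<lparr> pverts = G5_verts n,
       parcs = {(u, v). u \<in> G5_verts n \<and> v \<in> G5_verts n \<and> u \<noteq> v \<and> {u, v} \<notin> G5_nonedges n} \<rparr>"

lemma pair_graph_G5: "pair_graph (G5 n)"
proof
  have fin: "finite (G5_verts n)"
    by (simp add: G5_verts_def)
  show "finite (pverts (G5 n))"
    using fin by (simp add: G5_def)
  have "parcs (G5 n) \<subseteq> G5_verts n \<times> G5_verts n"
    by (auto simp: G5_def)
  then show "finite (parcs (G5 n))"
    using fin by (meson finite_SigmaI finite_subset)
  show "symmetric (with_proj (G5 n))"
    by (auto simp: symmetric_def arcs_ends_def arc_to_ends_def sym_def G5_def insert_commute)
qed (auto simp: G5_def)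

end

theory Submission imports Defs begin

text \<open>
  Deleting the vertex \<open>b\<^sub>n\<close> from the cycle leaves the path
  \<open>a\<^sub>1, b\<^sub>1, a\<^sub>2, \<dots>, b\<^bsub>n-1\<^esub>, a\<^sub>n\<close>. Its complement is represented by a
  concatenation of two permutations: one swaps the two vertices in each path edge \<open>b\<^sub>i a\<^bsub>i+1\<^esub>\<close>, the
  other those in each path edge \<open>a\<^sub>i b\<^sub>i\<close>, so exactly the consecutive vertices appear in
  different orders. Three occurrences of \<open>b\<^sub>n\<close> are then inserted so that
  every inner vertex of the path occurs exactly once between consecutive ones, while
  nothing of \<open>a\<^sub>1\<close> lies between the first two and nothing of \<open>a\<^sub>n\<close> between the last two.
\<close>

definition G5_word :: "nat \<Rightarrow> vertex list" where
  "G5_word n =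
     [A 1, B n] @ concat (map (\<lambda>k. [A (Suc k), B k]) [1..<n]) @
     [B n] @ concat (map (\<lambda>k. [B k, A k]) [1..<n]) @ [B n, A n]"

lemma alternate_commute: "alternate w i j \<longleftrightarrow> alternate w j i"
  by (auto simp: alternate_def restrict_word_def disj_commute)

lemma filter_concat_upt_single:
  assumes "\<And>k. k \<noteq> i \<Longrightarrow> filter P (f k) = []"
  shows "filter P (concat (map f [a..<b])) = (if a \<le> i \<and> i < b then filter P (f i) else [])"
  using assms by (induction b) (auto simp: less_Suc_eq)

text \<open>Used when the two letters sit in different blocks. The assumption \<open>i < j\<close>
  fixes the order of the output: the letter of the earlier block comes first.\<close>

lemma filter_concat_upt_pair:
  assumes "i < j" and "\<And>k. k \<noteq> i \<Longrightarrow> k \<noteq> j \<Longrightarrow> filter P (f k) = []"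
  shows "filter P (concat (map f [a..<b])) =
    (if a \<le> i \<and> i < b then filter P (f i) else []) @
    (if a \<le> j \<and> j < b then filter P (f j) else [])"
  using assms(2)
proof (induction b)
  case (Suc b)
  then show ?case
    using assms(1) by (cases "b = i"; cases "b = j") (auto simp: less_Suc_eq)
qed simp

lemma set_G5_word:
  assumes "n \<ge> 1"
  shows "set (G5_word n) \<subseteq> G5_verts n"
  using assms by (auto simp: G5_word_def G5_verts_def)

lemma restrict_G5_word:
  "restrict_word (G5_word n) u v =
     filter (\<lambda>x. x = u \<or> x = v) [A 1, B n] @
     filter (\<lambda>x. x = u \<or> x = v) (concat (map (\<lambda>k. [A (Suc k), B k]) [1..<n])) @
     filter (\<lambda>x. x = u \<or> x = v) [B n] @
     filter (\<lambda>x. x = u \<or> x = v) (concat (map (\<lambda>k. [B k, A k]) [1..<n])) @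
     filter (\<lambda>x. x = u \<or> x = v) [B n, A n]"
  by (simp only: restrict_word_def G5_word_def filter_append)

lemma alternate_A_A:
  assumes "i < j" "j < n"
  shows "alternate (G5_word n) (A (Suc i)) (A (Suc j))"
proof -
  let ?P = "\<lambda>x. x = A (Suc i) \<or> x = A (Suc j)"
  \<comment> \<open>\<open>A 1\<close> opens the word and lies in no block of the first
    half.\<close>
  have "filter ?P (concat (map (\<lambda>k. [A (Suc k), B k]) [1..<n])) =
      (if i = 0 then [A (Suc j)] else [A (Suc i), A (Suc j)])"
    using assms by (subst filter_concat_upt_pair[of i j]) auto
  \<comment> \<open>In the second half \<open>A n\<close> lies in no block: it closes the
    word.\<close>
  moreover have "filter ?P (concat (map (\<lambda>k. [B k, A k]) [1..<n])) =
      (if n = Suc j then [A (Suc i)] else [A (Suc i), A (Suc j)])"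
    using assms by (subst filter_concat_upt_pair[of "Suc i" "Suc j"]) auto
  ultimately have "restrict_word (G5_word n) (A (Suc i)) (A (Suc j)) =
      [A (Suc i), A (Suc j), A (Suc i), A (Suc j)]"
    unfolding restrict_G5_word using assms by (simp del: filter_concat)
  then show ?thesis
    using assms by (simp add: alternate_def sublist_Cons_right)
qed

lemma alternate_B_B:
  assumes "1 \<le> i" "i < j" "j \<le> n"
  shows "alternate (G5_word n) (B i) (B j)"
proof -
  \<comment> \<open>\<open>B n\<close> lies in no block; its three copies enclose one
    \<open>B i\<close> per half.\<close>
  have "restrict_word (G5_word n) (B i) (B j) =
      (if j = n then [B j, B i, B j, B i, B j] else [B i, B j, B i, B j])"
    unfolding restrict_G5_word using assms
    by (auto simp: filter_concat_upt_pair[of i j] simp del: filter_concat)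
  then show ?thesis
    using assms by (simp add: alternate_def sublist_Cons_right)
qed

lemma alternate_A_B:
  assumes "i < n" "1 \<le> j" "j \<le> n"
  shows "alternate (G5_word n) (A (Suc i)) (B j) \<longleftrightarrow> j \<noteq> i \<and> j \<noteq> Suc i \<and> \<not> (i = 0 \<and> j = n)"
proof -
  let ?a = "A (Suc i)" and ?b = "B j"
  \<comment> \<open>The first half compares block \<open>i\<close> with block \<open>j\<close>, the
    second compares block \<open>Suc i\<close> with block \<open>j\<close>. The orders differ
    exactly in the two middle cases, apart from the extra copies of \<open>B n\<close>.\<close>
  consider "j < i" | "j = i" | "j = Suc i" | "Suc i < j"
    by linarith
  then show ?thesis
  proof cases
    case 1
    have "restrict_word (G5_word n) ?a ?b = [?b, ?a, ?b, ?a]"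
      unfolding restrict_G5_word using assms 1
      by (auto simp: filter_concat_upt_pair[of j i] filter_concat_upt_pair[of j "Suc i"]
          simp del: filter_concat)
    then show ?thesis
      using assms 1 by (simp add: alternate_def sublist_Cons_right)
  next
    case 2
    have "restrict_word (G5_word n) ?a ?b = [?a, ?b, ?b, ?a]"
      unfolding restrict_G5_word using assms 2
      by (auto simp: filter_concat_upt_single[of i] filter_concat_upt_pair[of i "Suc i"]
          simp del: filter_concat)
    then show ?thesis
      using assms 2 by (simp add: alternate_def sublist_Cons_right)
  next
    case 3
    \<comment> \<open>With \<open>j = n\<close>, the subcase \<open>i = 0\<close> means
      \<open>n = 1\<close>, where \<open>A 1\<close> both opens and closes the word.\<close>
    have "restrict_word (G5_word n) ?a ?b =
        (if j = n then if i = 0 then [?a, ?b, ?b, ?b, ?a] else [?b, ?a, ?b, ?b, ?a]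
         else [?a, ?b, ?b, ?a])"
      unfolding restrict_G5_word using assms 3
      by (auto simp: filter_concat_upt_pair[of i "Suc i"] filter_concat_upt_single[of "Suc i"]
          simp del: filter_concat)
    then show ?thesis
      using assms 3 by (simp add: alternate_def sublist_Cons_right)
  next
    case 4
    \<comment> \<open>For \<open>i = 0\<close> and \<open>j = n\<close> the factor
      \<open>[?b, ?b]\<close> realizes the closing non-edge between \<open>A 1\<close> and
      \<open>B n\<close>.\<close>
    have "restrict_word (G5_word n) ?a ?b =
        (if j = n then if i = 0 then [?a, ?b, ?b, ?a, ?b] else [?b, ?a, ?b, ?a, ?b]
         else [?a, ?b, ?a, ?b])"
      unfolding restrict_G5_word using assms 4
      by (auto simp: filter_concat_upt_pair[of i j] filter_concat_upt_pair[of "Suc i" j]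
          simp del: filter_concat)
    then show ?thesis
      using assms 4 by (simp add: alternate_def sublist_Cons_right)
  qed
qed

lemma G5_nonedges_A_A: "{A i, A j} \<notin> G5_nonedges n"
  by (auto simp: G5_nonedges_def doubleton_eq_iff)

lemma G5_nonedges_B_B: "{B i, B j} \<notin> G5_nonedges n"
  by (auto simp: G5_nonedges_def doubleton_eq_iff)

text \<open>The bound \<open>1 \<le> j\<close> keeps \<open>j = i\<close> from holding at
  \<open>i = 0\<close>, where the cycle predecessor of \<open>A 1\<close> is \<open>B n\<close>
  instead.\<close>

lemma G5_nonedges_A_B:
  assumes "i < n" "1 \<le> j" "j \<le> n"
  shows "{A (Suc i), B j} \<in> G5_nonedges n \<longleftrightarrow> j = i \<or> j = Suc i \<or> i = 0 \<and> j = n"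
  using assms by (auto simp: G5_nonedges_def doubleton_eq_iff)

lemma alternate_G5_word:
  assumes "u \<in> G5_verts n" "v \<in> G5_verts n" "u \<noteq> v"
  shows "alternate (G5_word n) u v \<longleftrightarrow> {u, v} \<notin> G5_nonedges n"
proof -
  \<comment> \<open>Undoes the index shift \<open>Suc i\<close>; the order \<open>i < j\<close> is
    later removed by symmetry.\<close>
  have AA: "alternate (G5_word n) (A i) (A j)" if "1 \<le> i" "i < j" "j \<le> n" for i j
    using alternate_A_A[of "i - 1" "j - 1" n] that by simp
  have AB: "alternate (G5_word n) (A i) (B j) \<longleftrightarrow> {A i, B j} \<notin> G5_nonedges n"
    if "1 \<le> i" "i \<le> n" "1 \<le> j" "j \<le> n" for i j
    using alternate_A_B[of "i - 1" n j] G5_nonedges_A_B[of "i - 1" n j] that by auto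
  show ?thesis
  proof (cases u; cases v)
    fix i j assume uv: "u = A i" "v = A j"
    then have "1 \<le> i" "i \<le> n" "1 \<le> j" "j \<le> n" "i \<noteq> j"
      using assms by (auto simp: G5_verts_def)
    then have "alternate (G5_word n) (A i) (A j)"
      by (metis AA alternate_commute linorder_neqE_nat)
    then show ?thesis
      by (simp add: uv G5_nonedges_A_A)
  next
    fix i j assume uv: "u = B i" "v = B j"
    then have "1 \<le> i" "i \<le> n" "1 \<le> j" "j \<le> n" "i \<noteq> j"
      using assms by (auto simp: G5_verts_def)
    then have "alternate (G5_word n) (B i) (B j)"
      by (metis alternate_B_B alternate_commute linorder_neqE_nat)
    then show ?thesis
      by (simp add: uv G5_nonedges_B_B)
  next
    fix i j assume "u = A i" "v = B j"
    then show ?thesis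
      using assms AB[of i j] by (auto simp: G5_verts_def)
  next
    fix i j assume "u = B i" "v = A j"
    then show ?thesis
      using assms AB[of j i] alternate_commute[of "G5_word n" "A j" "B i"]
      by (auto simp: G5_verts_def insert_commute)
  qed
qed

theorem theorem5:
  fixes n :: nat
  assumes "n \<ge> 3"
  shows "word_representable (G5 n)"
  unfolding word_representable_def
  using assms set_G5_word[of n] alternate_G5_word[of _ n]
  by (intro exI[of _ "G5_word n"]) (auto simp: G5_def)

end
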